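(* For every integer $k$ with $1\leq k\leq 150$, $$\genfrac{[}{]}{0pt}{}{1/2+k}{k}_q \;\geq_q\; \genfrac{[}{]}{0pt}{}{1/3+k}{k}_q .$$
   Context: Let $\mathcal P=\bigcup_{b\ge 1}\mathbb{Q}[[q^{1/b}]]$ be the ring of Puiseux series over $\mathbb{Q}$ with nonnegative exponents (formal series in $q$ whose exponents are nonnegative rationals admitting a common denominator). For $A(q)=\sum_{\alpha\in\mathbb{Q}_{\ge 0}}a_\alpha q^\alpha\in\mathcal P$, the integer trace is $\operatorname{Tr}_{\mathbb Z}A(q):=\sum_{d\in\mathbb{Z}_{\ge 0}}a_d q^d\in\mathbb{Q}[[q]]$, i.e. all terms with nonintegral exponent are discarded. For $F,G\in\mathcal P$, write $F\geq_q G$ if and only if every coefficient of $\operatorname{Tr}_{\mathbb Z}(F-G)$ is nonnegative. For an integer $k\ge 0$ and a positive rational $r$, the generalized Gaussian binomial coefficient is the element of $\mathcal P$ $$\genfrac{[}{]}{0pt}{}{r+k}{k}_q=\frac{(1-q^{r+1})(1-q^{r+2})\cdots(1-q^{r+k})}{(1-q)(1-q^2)\cdots(1-q^k)}.$$ *)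

theory Defs
  imports "HOL-Computational_Algebra.Formal_Power_Series"
begin

section \<open>Puiseux series over the rationals with nonnegative exponents\<close>

text \<open>A series is its coefficient function on all rational exponents; the support has to
  lie in \<open>{n / b | n \<in> \<nat>}\<close> for one common denominator \<open>b \<ge> 1\<close>.\<close>

typedef puiseux =
  "{f :: rat \<Rightarrow> rat. \<exists>b::nat. b > 0 \<and> (\<forall>x. f x \<noteq> 0 \<longrightarrow> (\<exists>n::nat. x = of_nat n / of_nat b))}"
  morphisms pcoeff Abs_puiseux
  by (rule exI[of _ "\<lambda>_. 0"]) auto

setup_lifting type_definition_puiseux

lemma pcoeff_denom:
  obtains b :: nat where "b > 0" "\<And>x. pcoeff A x \<noteq> 0 \<Longrightarrow> \<exists>n::nat. x = of_nat n / of_nat b"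
  using pcoeff[of A] by auto

lemma puiseux_eqI: "(\<And>x. pcoeff A x = pcoeff B x) \<Longrightarrow> A = B"
  by (simp add: pcoeff_inject[symmetric] fun_eq_iff)

lemma common_denom_mult:
  fixes b c :: nat
  assumes "b > 0" "c > 0"
  shows "(of_nat n / of_nat b :: rat) = of_nat (n * c) / of_nat (b * c)"
    and "(of_nat n / of_nat c :: rat) = of_nat (n * b) / of_nat (b * c)"
  using assms by (simp_all add: field_simps)

lemma common_denom2:
  fixes f g :: "rat \<Rightarrow> rat"
  assumes "\<exists>b::nat. b > 0 \<and> (\<forall>x. f x \<noteq> 0 \<longrightarrow> (\<exists>n::nat. x = of_nat n / of_nat b))"
      and "\<exists>b::nat. b > 0 \<and> (\<forall>x. g x \<noteq> 0 \<longrightarrow> (\<exists>n::nat. x = of_nat n / of_nat b))"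
  shows "\<exists>b::nat. b > 0 \<and> (\<forall>x. f x \<noteq> 0 \<longrightarrow> (\<exists>n::nat. x = of_nat n / of_nat b))
                        \<and> (\<forall>x. g x \<noteq> 0 \<longrightarrow> (\<exists>n::nat. x = of_nat n / of_nat b))"
proof -
  obtain b c :: nat where bc: "b > 0" "c > 0"
    "\<forall>x. f x \<noteq> 0 \<longrightarrow> (\<exists>n::nat. x = of_nat n / of_nat b)"
    "\<forall>x. g x \<noteq> 0 \<longrightarrow> (\<exists>n::nat. x = of_nat n / of_nat c)"
    using assms by auto
  show ?thesis
    by (rule exI[of _ "b * c"]) (use bc common_denom_mult[OF bc(1,2)] in \<open>metis mult_pos_pos\<close>)
qed

text \<open>The product is the Cauchy product. The sum ranges over a finite set, because
  the exponents with nonzero coefficients lie in \<open>(1/b) \<nat>\<close>.\<close>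

instantiation puiseux :: comm_ring_1
begin

lift_definition zero_puiseux :: puiseux is "\<lambda>_. 0" by auto

lift_definition one_puiseux :: puiseux is "\<lambda>x. if x = 0 then 1 else 0"
  by (rule exI[of _ 1]) (auto intro: exI[of _ 0])

lift_definition plus_puiseux :: "puiseux \<Rightarrow> puiseux \<Rightarrow> puiseux" is "\<lambda>f g x. f x + g x"
  using common_denom2 by (metis (no_types, lifting) add.right_neutral)

lift_definition uminus_puiseux :: "puiseux \<Rightarrow> puiseux" is "\<lambda>f x. - f x"
  by auto

lift_definition minus_puiseux :: "puiseux \<Rightarrow> puiseux \<Rightarrow> puiseux" is "\<lambda>f g x. f x - g x"
  using common_denom2 by (metis (no_types, lifting) diff_zero)

lift_definition times_puiseux :: "puiseux \<Rightarrow> puiseux \<Rightarrow> puiseux"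
  is "\<lambda>f g x. \<Sum>y | f y \<noteq> 0 \<and> g (x - y) \<noteq> 0. f y * g (x - y)"
proof -
  fix f g :: "rat \<Rightarrow> rat"
  assume "\<exists>b::nat. b > 0 \<and> (\<forall>x. f x \<noteq> 0 \<longrightarrow> (\<exists>n::nat. x = of_nat n / of_nat b))"
     and "\<exists>b::nat. b > 0 \<and> (\<forall>x. g x \<noteq> 0 \<longrightarrow> (\<exists>n::nat. x = of_nat n / of_nat b))"
  from common_denom2[OF this] obtain b :: nat where b: "b > 0"
    "\<forall>x. f x \<noteq> 0 \<longrightarrow> (\<exists>n::nat. x = of_nat n / of_nat b)"
    "\<forall>x. g x \<noteq> 0 \<longrightarrow> (\<exists>n::nat. x = of_nat n / of_nat b)" by auto
  have "\<exists>n::nat. x = of_nat n / of_nat b"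
    if "(\<Sum>y | f y \<noteq> 0 \<and> g (x - y) \<noteq> 0. f y * g (x - y)) \<noteq> 0" for x
  proof -
    have "{y. f y \<noteq> 0 \<and> g (x - y) \<noteq> 0} \<noteq> {}"
      using that by (metis (no_types, lifting) sum.empty)
    then obtain y where y: "f y \<noteq> 0" "g (x - y) \<noteq> 0" by blast
    obtain i j :: nat where "y = of_nat i / of_nat b" "x - y = of_nat j / of_nat b"
      using b y by blast
    then have "x = of_nat (i + j) / of_nat b"
      by (simp add: add_divide_distrib algebra_simps)
    then show ?thesis by blast
  qed
  with b show "\<exists>b::nat. b > 0 \<and> (\<forall>x. (\<Sum>y | f y \<noteq> 0 \<and> g (x - y) \<noteq> 0. f y * g (x - y)) \<noteq> 0
      \<longrightarrow> (\<exists>n::nat. x = of_nat n / of_nat b))" by blast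
qed

text \<open>The image of a power series under \<open>X \<mapsto> q\<^sup>1\<^sup>/\<^sup>b\<close>; every Puiseux series arises in this way.\<close>

definition ram :: "nat \<Rightarrow> rat fps \<Rightarrow> puiseux" where
  "ram b F = Abs_puiseux (\<lambda>x. if \<exists>n::nat. x = of_nat n / of_nat b
                              then fps_nth F (THE n. x = of_nat n / of_nat b) else 0)"

lemma pcoeff_ram:
  assumes "b > 0"
  shows "pcoeff (ram b F) x = (if \<exists>n::nat. x = of_nat n / of_nat b
           then fps_nth F (THE n. x = of_nat n / of_nat b) else 0)"
  unfolding ram_def by (subst Abs_puiseux_inverse) (use assms in auto)

lemma pcoeff_ram_nat:
  assumes "b > 0"
  shows "pcoeff (ram b F) (of_nat n / of_nat b) = fps_nth F n"
proof -
  have "(THE m::nat. (of_nat n / of_nat b :: rat) = of_nat m / of_nat b) = n"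
    by (rule the_equality) (use assms in auto)
  then show ?thesis using assms by (auto simp: pcoeff_ram)
qed

lemma pcoeff_ram_not:
  assumes "b > 0" "\<not> (\<exists>n::nat. x = of_nat n / of_nat b)"
  shows "pcoeff (ram b F) x = 0"
  using assms by (simp add: pcoeff_ram)

lemma ram_eqI:
  assumes b: "b > 0"
    and 1: "\<And>n. pcoeff A (of_nat n / of_nat b) = fps_nth F n"
    and 2: "\<And>x. \<not> (\<exists>n::nat. x = of_nat n / of_nat b) \<Longrightarrow> pcoeff A x = 0"
  shows "A = ram b F"
proof (rule puiseux_eqI)
  fix x show "pcoeff A x = pcoeff (ram b F) x"
    using 1 2[of x] pcoeff_ram_nat[OF b] pcoeff_ram_not[OF b] by (metis (full_types))
qed

lemma ram_surj:
  assumes "b > 0" "\<And>x. pcoeff A x \<noteq> 0 \<Longrightarrow> \<exists>n::nat. x = of_nat n / of_nat b"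
  obtains F where "A = ram b F"
proof -
  have "A = ram b (Abs_fps (\<lambda>n. pcoeff A (of_nat n / of_nat b)))"
    by (rule ram_eqI) (use assms in auto)
  then show ?thesis using that by blast
qed

lemma ram_surj3:
  obtains b F G H where "b > 0" "A = ram b F" "B = ram b G" "C = ram b H"
proof -
  obtain a where a: "a > 0" "\<And>x. pcoeff A x \<noteq> 0 \<Longrightarrow> \<exists>n::nat. x = of_nat n / of_nat a"
    using pcoeff_denom[of A] by metis
  obtain b where b: "b > 0" "\<And>x. pcoeff B x \<noteq> 0 \<Longrightarrow> \<exists>n::nat. x = of_nat n / of_nat b"
    using pcoeff_denom[of B] by metis
  obtain c where c: "c > 0" "\<And>x. pcoeff C x \<noteq> 0 \<Longrightarrow> \<exists>n::nat. x = of_nat n / of_nat c"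
    using pcoeff_denom[of C] by metis
  have lift: "\<exists>n::nat. x = of_nat n / of_nat (d * e)"
    if "d > 0" "e > 0" "\<exists>n::nat. x = of_nat n / of_nat d" for d e and x :: rat
    using that common_denom_mult(1)[OF that(1,2)] by blast
  have pos: "a * b * c > 0" using a b c by simp
  obtain F where "A = ram (a * b * c) F"
    by (rule ram_surj[OF pos, of A]) (use lift[of a "b * c"] a b c in \<open>auto simp: mult_ac\<close>)
  moreover obtain G where "B = ram (a * b * c) G"
    by (rule ram_surj[OF pos, of B]) (use lift[of b "a * c"] a b c in \<open>auto simp: mult_ac\<close>)
  moreover obtain H where "C = ram (a * b * c) H"
    by (rule ram_surj[OF pos, of C]) (use lift[of c "a * b"] a b c in \<open>auto simp: mult_ac\<close>)
  ultimately show ?thesis using pos that by blast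
qed

lemma ram_0: "b > 0 \<Longrightarrow> (0 :: puiseux) = ram b 0"
  by (rule ram_eqI) (auto simp: zero_puiseux.rep_eq)

lemma ram_1: "b > 0 \<Longrightarrow> (1 :: puiseux) = ram b 1"
  by (rule ram_eqI) (auto simp: one_puiseux.rep_eq intro: exI[of _ 0])

lemma ram_add: "b > 0 \<Longrightarrow> ram b F + ram b G = ram b (F + G)"
  by (rule ram_eqI) (auto simp: plus_puiseux.rep_eq pcoeff_ram_nat pcoeff_ram_not)

lemma ram_diff: "b > 0 \<Longrightarrow> ram b F - ram b G = ram b (F - G)"
  by (rule ram_eqI) (auto simp: minus_puiseux.rep_eq pcoeff_ram_nat pcoeff_ram_not)

lemma ram_uminus: "b > 0 \<Longrightarrow> - ram b F = ram b (- F)"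
  by (rule ram_eqI) (auto simp: uminus_puiseux.rep_eq pcoeff_ram_nat pcoeff_ram_not)

lemma ram_mult:
  assumes b: "b > 0"
  shows "ram b F * ram b G = ram b (F * G)"
proof (rule ram_eqI[OF b])
  fix n :: nat
  let ?f = "pcoeff (ram b F)" and ?g = "pcoeff (ram b G)"
  let ?x = "of_nat n / of_nat b :: rat"
  let ?h = "\<lambda>i. of_nat i / of_nat b :: rat"
  have sub: "?x - ?h i = ?h (n - i)" if "i \<le> n" for i
    using that by (simp add: of_nat_diff diff_divide_distrib)
  have S: "{y. ?f y \<noteq> 0 \<and> ?g (?x - y) \<noteq> 0} \<subseteq> ?h ` {0..n}"
  proof safe
    fix y assume "?f y \<noteq> 0" "?g (?x - y) \<noteq> 0"
    then obtain i j where ij: "y = ?h i" "?x - y = ?h j"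
      using pcoeff_ram_not[OF b] by metis
    then have "?h n = ?h (i + j)" by (simp add: add_divide_distrib algebra_simps)
    then have "n = i + j" using b by (metis divide_cancel_right of_nat_eq_iff of_nat_0 less_irrefl)
    then show "y \<in> ?h ` {0..n}" using ij by auto
  qed
  have inj: "inj_on ?h {0..n}" using b by (auto simp: inj_on_def)
  have "pcoeff (ram b F * ram b G) ?x = (\<Sum>y | ?f y \<noteq> 0 \<and> ?g (?x - y) \<noteq> 0. ?f y * ?g (?x - y))"
    by (simp add: times_puiseux.rep_eq)
  also have "\<dots> = (\<Sum>y\<in>?h ` {0..n}. ?f y * ?g (?x - y))"
    by (rule sum.mono_neutral_left) (use S in auto)
  also have "\<dots> = (\<Sum>i=0..n. ?f (?h i) * ?g (?x - ?h i))"
    by (subst sum.reindex[OF inj]) simp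
  also have "\<dots> = (\<Sum>i=0..n. fps_nth F i * fps_nth G (n - i))"
    by (rule sum.cong[OF refl]) (simp only: sub atLeastAtMost_iff pcoeff_ram_nat[OF b])
  finally show "pcoeff (ram b F * ram b G) ?x = fps_nth (F * G) n"
    by (simp add: fps_mult_nth)
next
  fix x :: rat
  assume x: "\<not> (\<exists>n::nat. x = of_nat n / of_nat b)"
  have "{y. pcoeff (ram b F) y \<noteq> 0 \<and> pcoeff (ram b G) (x - y) \<noteq> 0} = {}"
  proof safe
    fix y assume "pcoeff (ram b F) y \<noteq> 0" "pcoeff (ram b G) (x - y) \<noteq> 0"
    then obtain i j :: nat where ij: "y = of_nat i / of_nat b" "x - y = of_nat j / of_nat b"
      using pcoeff_ram_not[OF b] by metis
    then have "x = of_nat (i + j) / of_nat b" by (simp add: add_divide_distrib algebra_simps)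
    with x show "y \<in> {}" by blast
  qed
  then show "pcoeff (ram b F * ram b G) x = 0" by (simp only: times_puiseux.rep_eq sum.empty)
qed

instance
proof
  fix A B C :: puiseux
  obtain b F G H where b: "b > 0" and [simp]: "A = ram b F" "B = ram b G" "C = ram b H"
    by (rule ram_surj3)
  note [simp] = ram_0[OF b] ram_1[OF b] ram_add[OF b] ram_diff[OF b] ram_uminus[OF b] ram_mult[OF b]
  show "A * B * C = A * (B * C)" by (simp add: mult.assoc)
  show "A * B = B * A" by (simp add: mult.commute)
  show "1 * A = A" by simp
  show "A + B + C = A + (B + C)" by (simp add: add.assoc)
  show "A + B = B + A" by (simp add: add.commute)
  show "0 + A = A" by simp
  show "- A + A = 0" by simp
  show "A - B = A + - B" by simp
  show "(A + B) * C = A * C + B * C" by (simp add: distrib_right)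
next
  have "pcoeff 0 0 \<noteq> pcoeff 1 0" by (simp add: zero_puiseux.rep_eq one_puiseux.rep_eq)
  then show "(0 :: puiseux) \<noteq> 1" by metis
qed

end

text \<open>Division by a unit of the ring; it is used below only for the unit
  \<open>(1 - q) \<cdots> (1 - q\<^sup>k)\<close> (lemma \<open>qfact_unit\<close>). The inverse of a non-unit is set to 0.\<close>

instantiation puiseux :: inverse
begin

definition inverse_puiseux :: "puiseux \<Rightarrow> puiseux" where
  "inverse A = (if A dvd 1 then THE B. A * B = 1 else 0)" for A :: puiseux

definition divide_puiseux :: "puiseux \<Rightarrow> puiseux \<Rightarrow> puiseux" where
  "A div B = A * inverse B" for A B :: puiseux

instance ..

end

lemma puiseux_inverse:
  fixes A :: puiseux
  assumes "A dvd 1"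
  shows "A * inverse A = 1"
proof -
  obtain B where B: "A * B = 1" using assms by (metis dvdE)
  have "(THE B. A * B = 1) = B"
  proof (rule the_equality, rule B)
    fix C assume C: "A * C = 1"
    have "C = C * (A * B)" using B by simp
    also have "\<dots> = (A * C) * B" by (simp only: mult_ac)
    finally show "C = B" using C by simp
  qed
  then show ?thesis using assms B by (simp add: inverse_puiseux_def)
qed

text \<open>The monomial \<open>q\<^sup>\<alpha>\<close>. Only exponents \<open>\<alpha> \<ge> 0\<close> are meaningful; for \<open>\<alpha> < 0\<close> it is set to 0.\<close>

lift_definition qpow :: "rat \<Rightarrow> puiseux" is "\<lambda>\<alpha> x. if x = \<alpha> \<and> \<alpha> \<ge> 0 then 1 else 0"
proof -
  fix \<alpha> :: rat
  show "\<exists>b::nat. b > 0 \<and> (\<forall>x. (if x = \<alpha> \<and> \<alpha> \<ge> 0 then 1 else 0 :: rat) \<noteq> 0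
          \<longrightarrow> (\<exists>n::nat. x = of_nat n / of_nat b))"
  proof (cases "\<alpha> \<ge> 0")
    case True
    obtain p q where pq: "quotient_of \<alpha> = (p, q)" by (cases "quotient_of \<alpha>")
    have q: "q > 0" and \<alpha>: "\<alpha> = of_int p / of_int q"
      using quotient_of_denom_pos[OF pq] quotient_of_div[OF pq] by auto
    then have "p \<ge> 0" using True by (simp add: zero_le_divide_iff)
    then have "\<alpha> = of_nat (nat p) / of_nat (nat q)" using q \<alpha> by simp
    then show ?thesis using q by (intro exI[of _ "nat q"]) auto
  qed auto
qed

definition gauss_binom :: "rat \<Rightarrow> nat \<Rightarrow> puiseux" where
  "gauss_binom r k = (\<Prod>i=1..k. 1 - qpow (r + of_nat i)) / (\<Prod>i=1..k. 1 - qpow (of_nat i))"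
    \<comment> \<open>the coefficient written with upper entry \<open>r + k\<close> and lower entry \<open>k\<close>\<close>

definition int_trace :: "puiseux \<Rightarrow> rat fps" where
  "int_trace A = Abs_fps (\<lambda>d. pcoeff A (of_nat d))"

definition q_geq :: "puiseux \<Rightarrow> puiseux \<Rightarrow> bool" (infix \<open>\<ge>\<^sub>q\<close> 50) where
  "F \<ge>\<^sub>q G \<longleftrightarrow> (\<forall>d. fps_nth (int_trace (F - G)) d \<ge> 0)"

lemma qpow_0: "qpow 0 = 1"
  by (rule puiseux_eqI) (simp add: qpow.rep_eq one_puiseux.rep_eq)

lemma qpow_eq_ram: "b > 0 \<Longrightarrow> qpow (of_nat n / of_nat b) = ram b (fps_X ^ n)"
  by (rule ram_eqI) (auto simp: qpow.rep_eq)

lemma qpow_add: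
  assumes "\<alpha> \<ge> 0" "\<beta> \<ge> 0"
  shows "qpow (\<alpha> + \<beta>) = qpow \<alpha> * qpow \<beta>"
proof (rule puiseux_eqI)
  fix x
  have "{y. pcoeff (qpow \<alpha>) y \<noteq> 0 \<and> pcoeff (qpow \<beta>) (x - y) \<noteq> 0} = (if x = \<alpha> + \<beta> then {\<alpha>} else {})"
    using assms by (auto simp: qpow.rep_eq)
  then show "pcoeff (qpow (\<alpha> + \<beta>)) x = pcoeff (qpow \<alpha> * qpow \<beta>) x"
    using assms by (simp add: times_puiseux.rep_eq qpow.rep_eq)
qed

lemma qfact_unit: "(\<Prod>i=1..k. 1 - qpow (of_nat i)) dvd 1"
proof -
  have "1 - qpow (of_nat i) dvd 1" if "i \<in> {1..k}" for i
  proof -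
    have 1: "1 - qpow (of_nat i) = ram 1 (1 - fps_X ^ i)"
      using qpow_eq_ram[of 1 i] ram_diff[of 1 1 "fps_X ^ i"] ram_1[of 1] by simp
    have "(1 - fps_X ^ i :: rat fps) * inverse (1 - fps_X ^ i) = 1"
      by (rule inverse_mult_eq_1') (use that in auto)
    then have "(1 - qpow (of_nat i)) * ram 1 (inverse (1 - fps_X ^ i)) = 1"
      unfolding 1 by (simp add: ram_mult ram_1[of 1])
    then show ?thesis by (metis dvdI)
  qed
  then show ?thesis
    using prod_dvd_prod[of "{1..k}" "\<lambda>i. 1 - qpow (of_nat i)" "\<lambda>_. 1"] by simp
qed

lemma gauss_binom_mult:
  "gauss_binom r k * (\<Prod>i=1..k. 1 - qpow (of_nat i)) = (\<Prod>i=1..k. 1 - qpow (r + of_nat i))"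
  using puiseux_inverse[OF qfact_unit[of k]]
  by (simp add: gauss_binom_def divide_puiseux_def mult.assoc mult.commute[of "inverse _"])

end

theory Submission
  imports Defs
begin

text \<open>Write \<open>(q)\<^sub>m = (1 - q) \<cdots> (1 - q ^ m)\<close>. By the \<open>q\<close>-binomial theorem the generalized Gaussian
  binomial coefficient with upper entry \<open>r + k\<close> is the sum over \<open>j \<le> k\<close> of
  \<open>(- 1) ^ j * q powr (r * j + j * (j + 1) / 2)\<close> divided by \<open>(q)\<^sub>j * (q)\<^sub>k\<^sub>-\<^sub>j\<close>. For
  \<open>r = 1/2\<close> the integer trace keeps exactly the even \<open>j\<close>, all with positive sign; for \<open>r = 1/3\<close> it
  keeps the multiples of 3, and only the multiples \<open>6 * n\<close> of 6 have positive sign. So each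
  term of index \<open>6 * n\<close> for \<open>r = 1/3\<close> has to be dominated by terms of even index for \<open>r = 1/2\<close>,
  with disjoint sets of indices for different \<open>n\<close>. The indices
  \<open>6 * n - 2\<close>, \<open>6 * n\<close>, \<open>6 * n + 2\<close> serve this purpose (for \<open>n = 0\<close> the terms of index 0 agree).

  Put \<open>b = k - 6 * n\<close> and \<open>P i j = 1 / ((q)\<^sub>i * (q)\<^sub>j)\<close>. After division by a common power of \<open>q\<close>, the
  claim for \<open>n \<ge> 1\<close> is that, coefficientwise,
  \<open>q ^ (11 * n) * (1 - q ^ n) * P (6 * n) b\<close> is at most
  \<open>P (6 * n - 2) (b + 2) + q ^ (24 * n + 4) * P (6 * n + 2) (b - 2)\<close>
  (lemma \<open>pair_gf_domination\<close>), where the last summand is absent if \<open>b < 2\<close>. Like binomial coefficients, the series \<open>P i j\<close> with fixed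
  \<open>i + j\<close> increase coefficientwise towards the middle (lemma \<open>pair_gf_balance\<close>).
  This settles the case of small \<open>b\<close>. In the other cases the factor \<open>1 - q ^ n\<close> cancels
  against \<open>(q)\<^sub>6\<^sub>n\<close>, and cancelling all common factors except one \<open>1 / (1 - q)\<close> leaves
  comparisons of partial sums of products of few geometric series (lemmas \<open>middle_range\<close> and \<open>upper_range\<close>). There is so much room in these
  that all exponents can be rounded to multiples of \<open>5 * n\<close>, after which they are
  inequalities for explicit rational functions in one variable.\<close>

section \<open>Coefficientwise comparison\<close>

definition coeff_le :: "rat fps \<Rightarrow> rat fps \<Rightarrow> bool" (infix "\<preceq>" 50) where
  "F \<preceq> G \<longleftrightarrow> (\<forall>n. fps_nth F n \<le> fps_nth G n)"

lemma coeff_le_refl [simp]: "F \<preceq> F"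
  by (simp add: coeff_le_def)

lemma coeff_le_trans [trans]: "F \<preceq> G \<Longrightarrow> G \<preceq> H \<Longrightarrow> F \<preceq> H"
  unfolding coeff_le_def using order_trans by blast

text \<open>Calculations that mix \<open>=\<close> and \<open>\<preceq>\<close> chain through these rules instead of a search for
  higher-order substitution instances.\<close>

lemma coeff_le_eq_trans [trans]: "F \<preceq> G \<Longrightarrow> G = H \<Longrightarrow> F \<preceq> H" "F = G \<Longrightarrow> G \<preceq> H \<Longrightarrow> F \<preceq> H"
  by simp_all

lemma coeff_le_add: "F \<preceq> G \<Longrightarrow> F' \<preceq> G' \<Longrightarrow> F + F' \<preceq> G + G'"
  by (simp add: coeff_le_def add_mono)

lemma coeff_le_diff_iff: "F \<preceq> G \<longleftrightarrow> 0 \<preceq> G - F"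
  by (simp add: coeff_le_def)

lemma coeff_le_sum: "(\<And>i. i \<in> A \<Longrightarrow> F i \<preceq> G i) \<Longrightarrow> sum F A \<preceq> sum G A"
  by (simp add: coeff_le_def fps_sum_nth sum_mono)

lemma nonneg_mult: "0 \<preceq> F \<Longrightarrow> 0 \<preceq> G \<Longrightarrow> 0 \<preceq> F * G"
  by (simp add: coeff_le_def fps_mult_nth sum_nonneg)

lemma coeff_le_mult_left: "0 \<preceq> H \<Longrightarrow> F \<preceq> G \<Longrightarrow> H * F \<preceq> H * G"
  using nonneg_mult[of H "G - F"] unfolding coeff_le_diff_iff[of F] coeff_le_diff_iff[of "H * F"]
  by (simp only: right_diff_distrib)

lemma nonneg_X_power [simp]: "0 \<preceq> fps_X ^ m"
  by (simp add: coeff_le_def fps_X_power_nth)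

lemma nonneg_add: "0 \<preceq> F \<Longrightarrow> 0 \<preceq> G \<Longrightarrow> 0 \<preceq> F + G"
  using coeff_le_add[of 0 F 0 G] by simp

lemma nonneg_one [simp]: "0 \<preceq> 1"
  by (simp add: coeff_le_def)

lemma nonneg_numeral [simp]: "0 \<preceq> numeral w"
  by (simp add: coeff_le_def fps_numeral_nth)

lemma nonneg_sum: "(\<And>i. i \<in> A \<Longrightarrow> 0 \<preceq> F i) \<Longrightarrow> 0 \<preceq> sum F A"
  by (simp add: coeff_le_def fps_sum_nth sum_nonneg)

lemma nonneg_prod: "(\<And>i. i \<in> A \<Longrightarrow> 0 \<preceq> F i) \<Longrightarrow> 0 \<preceq> prod F A"
  by (induction A rule: infinite_finite_induct) (auto intro: nonneg_mult)

section \<open>Geometric series and comparison of partial sums\<close>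

definition geo :: "nat \<Rightarrow> rat fps" where
  "geo m = inverse (1 - fps_X ^ m)"

lemma geo_cancel: "m \<ge> 1 \<Longrightarrow> (1 - fps_X ^ m) * geo m = 1"
  unfolding geo_def by (rule inverse_mult_eq_1') auto

lemma geo_unfold: "m \<ge> 1 \<Longrightarrow> geo m = 1 + fps_X ^ m * geo m"
  using geo_cancel[of m] by (simp add: algebra_simps)

lemma nonneg_geo:
  assumes "m \<ge> 1" shows "0 \<preceq> geo m"
proof -
  have "0 \<le> fps_nth (geo m) n" for n
  proof (induction n rule: less_induct)
    case (less n)
    have "fps_nth (geo m) n = fps_nth (1 + fps_X ^ m * geo m) n"
      using geo_unfold[OF assms] by simp
    then show ?case using less[of "n - m"] assms by (simp add: fps_X_power_mult_nth)
  qed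
  then show ?thesis by (simp add: coeff_le_def)
qed

lemma one_le_geo: "m \<ge> 1 \<Longrightarrow> 1 \<preceq> geo m"
  using coeff_le_add[OF coeff_le_refl nonneg_mult[OF nonneg_X_power nonneg_geo], of m 1 m] geo_unfold[of m] by simp

text \<open>Writing an exponent as \<open>i + c * l\<close> with \<open>i < c\<close>, in units of \<open>m\<close>.\<close>

lemma geo_multiple:
  assumes "m \<ge> 1" "c \<ge> 1"
  shows "geo m = (\<Sum>i<c. fps_X ^ (m * i)) * geo (m * c)"
proof -
  have "(1 - fps_X ^ m) * (\<Sum>i<c. fps_X ^ (m * i)) = (1 - fps_X ^ (m * c) :: rat fps)"
    using one_diff_power_eq[of "fps_X ^ m :: rat fps" c] by (simp add: power_mult)
  then have "(1 - fps_X ^ m) * ((\<Sum>i<c. fps_X ^ (m * i)) * geo (m * c)) = 1"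
    using geo_cancel[of "m * c"] assms by (simp add: mult.assoc[symmetric])
  then have "geo m * ((1 - fps_X ^ m) * ((\<Sum>i<c. fps_X ^ (m * i)) * geo (m * c))) = geo m" by simp
  then have "((1 - fps_X ^ m) * geo m) * ((\<Sum>i<c. fps_X ^ (m * i)) * geo (m * c)) = geo m"
    by (simp only: mult_ac)
  then show ?thesis by (simp only: geo_cancel[OF assms(1)] mult_1_left)
qed

text \<open>Division by \<open>1 - X\<close> turns coefficients into their partial sums. All products below
  contain such a factor to spare, and after dividing by it one may move terms freely: lowering an
  exponent increases all partial sums. This makes series with different step widths comparable,
  which they are not coefficientwise.\<close>

definition psum_le :: "rat fps \<Rightarrow> rat fps \<Rightarrow> bool" (infix "\<sqsubseteq>" 50) where
  "F \<sqsubseteq> G \<longleftrightarrow> geo 1 * F \<preceq> geo 1 * G"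

lemma coeff_le_imp_psum_le: "F \<preceq> G \<Longrightarrow> F \<sqsubseteq> G"
  by (simp add: psum_le_def coeff_le_mult_left nonneg_geo)

lemma psum_le_trans [trans]: "F \<sqsubseteq> G \<Longrightarrow> G \<sqsubseteq> H \<Longrightarrow> F \<sqsubseteq> H"
  unfolding psum_le_def by (rule coeff_le_trans)

lemma psum_le_eq_trans [trans]: "F \<sqsubseteq> G \<Longrightarrow> G = H \<Longrightarrow> F \<sqsubseteq> H" "F = G \<Longrightarrow> G \<sqsubseteq> H \<Longrightarrow> F \<sqsubseteq> H"
  by simp_all

lemma psum_le_add: "F \<sqsubseteq> G \<Longrightarrow> F' \<sqsubseteq> G' \<Longrightarrow> F + F' \<sqsubseteq> G + G'"
  by (simp add: psum_le_def distrib_left coeff_le_add)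

lemma psum_le_diff_iff: "F \<sqsubseteq> G \<longleftrightarrow> 0 \<sqsubseteq> G - F"
  unfolding psum_le_def coeff_le_diff_iff[of "geo 1 * F"] by (simp only: right_diff_distrib mult_zero_right diff_zero)

lemma psum_le_mult_left: "0 \<preceq> H \<Longrightarrow> F \<sqsubseteq> G \<Longrightarrow> H * F \<sqsubseteq> H * G"
  unfolding psum_le_def mult.left_commute[of "geo 1" H] by (rule coeff_le_mult_left)

lemma psum_le_mult:
  assumes "0 \<preceq> F" "0 \<preceq> G'" "F \<sqsubseteq> G" "F' \<sqsubseteq> G'"
  shows "F * F' \<sqsubseteq> G * G'"
  using psum_le_trans[OF psum_le_mult_left[OF assms(1,4)]] psum_le_mult_left[OF assms(2,3)]
  by (simp add: mult.commute)

lemma X_power_psum_anti: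
  assumes "b \<le> a" shows "fps_X ^ a \<sqsubseteq> fps_X ^ b"
proof -
  define c where "c = a - b"
  have a: "a = b + c" using assms by (simp add: c_def)
  have "(1 - fps_X) * (\<Sum>i<c. fps_X ^ i) = (1 - fps_X ^ c :: rat fps)"
    by (simp add: one_diff_power_eq)
  then have "fps_X ^ b - fps_X ^ a = fps_X ^ b * ((1 - fps_X ^ 1) * (\<Sum>i<c. fps_X ^ i) :: rat fps)"
    by (simp add: a power_add right_diff_distrib)
  then have "geo 1 * (fps_X ^ b - fps_X ^ a) = (1 - fps_X ^ 1) * geo 1 * (fps_X ^ b * (\<Sum>i<c. fps_X ^ i))"
    by (simp only: mult_ac)
  then have "geo 1 * (fps_X ^ b - fps_X ^ a) = fps_X ^ b * (\<Sum>i<c. fps_X ^ i)"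
    by (simp only: geo_cancel[OF order_refl] mult_1_left)
  then show ?thesis
    by (subst psum_le_diff_iff) (simp add: psum_le_def nonneg_mult nonneg_sum)
qed

lemma geo_psum_anti:
  assumes "1 \<le> b" "b \<le> a" shows "geo a \<sqsubseteq> geo b"
proof -
  have "geo b - geo a = geo b * ((1 - fps_X ^ a) * geo a) - geo a * ((1 - fps_X ^ b) * geo b)"
    using assms by (simp only: geo_cancel mult_1_right order_trans[OF assms])
  also have "\<dots> = geo a * geo b * (fps_X ^ b - fps_X ^ a)"
    by (simp add: algebra_simps)
  finally have *: "geo b - geo a = geo a * geo b * (fps_X ^ b - fps_X ^ a)" .
  show ?thesis
    using psum_le_mult_left[of "geo a * geo b" 0 "fps_X ^ b - fps_X ^ a"] X_power_psum_anti[OF assms(2)] assms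
    by (subst psum_le_diff_iff) (simp add: * nonneg_mult nonneg_geo psum_le_diff_iff[of "fps_X ^ a"])
qed

section \<open>Two comparisons of products of geometric series\<close>

text \<open>The next lemmas replace step widths \<open>6 * n - 1\<close>, \<open>6 * n\<close>, \<open>n\<close> by multiples of \<open>5 * n\<close>, at
  a loss that the final inequalities can afford. What remains are inequalities between rational
  functions of the single quantity \<open>y = X ^ (5 * n)\<close> in which \<open>n\<close> no longer occurs.\<close>

lemma pair_psum_le:
  assumes "n \<ge> 1"
  shows "fps_X ^ (11*n) * (geo (6*n - 1) * geo (6*n)) \<sqsubseteq> (fps_X ^ (5*n))\<^sup>2 * (geo (5*n))\<^sup>2"
proof -
  have *: "(fps_X ^ (5*n))\<^sup>2 = (fps_X ^ (10*n) :: rat fps)"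
    by (simp flip: power_mult)
  show ?thesis
    unfolding * power2_eq_square[of "geo (5*n)"]
    by (intro psum_le_mult nonneg_X_power X_power_psum_anti nonneg_mult geo_psum_anti nonneg_geo) (use assms in auto)
qed

lemma geo_psum_ge:
  assumes "n \<ge> 1"
  shows "(1 + 4 * fps_X ^ (5*n)) * geo (5*n) \<sqsubseteq> geo n"
proof -
  \<comment> \<open>Raise four of the exponents \<open>0, n, \<dots>, 4 * n\<close> to \<open>5 * n\<close>.\<close>
  have "1 + 4 * fps_X ^ (5*n) = fps_X ^ (n*0) + fps_X ^ (5*n) + fps_X ^ (5*n) + fps_X ^ (5*n) + (fps_X ^ (5*n) :: rat fps)"
    by simp
  also have "\<dots> \<sqsubseteq> fps_X ^ (n*0) + fps_X ^ (n*1) + fps_X ^ (n*2) + fps_X ^ (n*3) + fps_X ^ (n*4)"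
    by (intro psum_le_add X_power_psum_anti) auto
  also have "\<dots> = (\<Sum>i<5. fps_X ^ (n*i))"
    by (simp add: eval_nat_numeral)
  finally have "geo (5*n) * (1 + 4 * fps_X ^ (5*n)) \<sqsubseteq> geo (5*n) * (\<Sum>i<5. fps_X ^ (n*i))"
    by (rule psum_le_mult_left[rotated]) (use assms in \<open>simp add: nonneg_geo\<close>)
  then show ?thesis
    using geo_multiple[OF assms, of 5] by (simp add: mult.commute)
qed

lemma geo_double:
  assumes "m \<ge> 1" shows "geo m = (1 + fps_X ^ m) * geo (2*m)"
  using geo_multiple[OF assms, of 2] by (simp add: eval_nat_numeral mult.commute)

lemma X_power_power_psum_anti: "m \<ge> 1 \<Longrightarrow> b \<le> a \<Longrightarrow> (fps_X ^ m) ^ a \<sqsubseteq> (fps_X ^ m) ^ b"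
  unfolding power_mult[symmetric] by (rule X_power_psum_anti) simp

text \<open>With \<open>y = X ^ (5 * n)\<close>, it is enough to show
  \<open>y\<^sup>2 / (1 - y)\<^sup>2 \<sqsubseteq> (1 + 4 * y) / ((1 - y) * (1 - y\<^sup>2))\<close>. The
  denominator \<open>(1 - y) * (1 - y\<^sup>2)\<close> can be cleared on both sides, which leaves
  \<open>y\<^sup>2 + y\<^sup>3 \<sqsubseteq> 1 + 4 * y\<close>, and this is clear because lower exponents win.\<close>

lemma middle_range:
  assumes "n \<ge> 1" "b + 1 \<le> 10*n"
  shows "fps_X ^ (11*n) * (geo (6*n - 1) * geo (6*n)) \<sqsubseteq> geo n * (geo (b+1) * geo (b+2))"
proof -
  define y :: "rat fps" where "y = fps_X ^ (5*n)"
  have ypow: "y ^ i \<sqsubseteq> y ^ j" if "j \<le> i" for i j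
    unfolding y_def using assms that by (intro X_power_power_psum_anti) auto
  have y0: "0 \<preceq> y" by (simp add: y_def)
  note pos = nonneg_mult nonneg_geo nonneg_add nonneg_one y0
  have "y ^ 2 + y ^ 3 \<sqsubseteq> y ^ 0 + y ^ 1"
    by (intro psum_le_add ypow) auto
  also have "\<dots> \<sqsubseteq> y ^ 0 + y ^ 1 + 3 * y"
    by (subst psum_le_diff_iff) (simp add: coeff_le_imp_psum_le nonneg_mult y0)
  also have "\<dots> = 1 + 4 * y" by simp
  finally have num: "y ^ 2 + y ^ 3 \<sqsubseteq> 1 + 4 * y" .
  have g5: "geo (5*n) = (1 + y) * geo (10*n)"
    using geo_double[of "5*n"] assms by (simp add: y_def)
  have "fps_X ^ (11*n) * (geo (6*n - 1) * geo (6*n)) \<sqsubseteq> y\<^sup>2 * (geo (5*n))\<^sup>2"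
    unfolding y_def by (rule pair_psum_le[OF assms(1)])
  also have "\<dots> = geo (5*n) * geo (10*n) * (y ^ 2 + y ^ 3)"
  proof -
    have "y\<^sup>2 * (geo (5*n))\<^sup>2 = y\<^sup>2 * geo (5*n) * ((1 + y) * geo (10*n))"
      by (simp add: power2_eq_square flip: g5)
    then show ?thesis by (simp add: algebra_simps power2_eq_square power3_eq_cube)
  qed
  also have "\<dots> \<sqsubseteq> geo (5*n) * geo (10*n) * (1 + 4 * y)"
    by (intro psum_le_mult_left pos num) (use assms in auto)
  also have "\<dots> = geo (10*n) * ((1 + 4 * y) * geo (5*n))"
    by (simp add: algebra_simps)
  also have "\<dots> \<sqsubseteq> geo (10*n) * geo n"
    unfolding y_def by (intro psum_le_mult_left nonneg_geo geo_psum_ge) (use assms in auto)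
  also have "\<dots> = geo n * geo (10*n)" by simp
  also have "\<dots> \<sqsubseteq> geo n * geo (b+1)"
    by (intro psum_le_mult_left nonneg_geo geo_psum_anti) (use assms in auto)
  also have "\<dots> = geo n * (geo (b+1) * 1)" by simp
  also have "\<dots> \<sqsubseteq> geo n * (geo (b+1) * geo (b+2))"
    by (intro psum_le_mult_left nonneg_geo coeff_le_imp_psum_le one_le_geo) (use assms in auto)
  finally show ?thesis .
qed

text \<open>Here no second geometric series is available in the first summand, so it dominates only in low
  degrees, and the last summand, of cubic growth, has to take over. With \<open>y = X ^ (5 * n)\<close> the
  inequality reduces to
  \<open>y\<^sup>2 / (1 - y)\<^sup>2 \<sqsubseteq> (1 + 4 * y) / (1 - y) + y ^ 6 * (1 + 4 * y) / ((1 - y) * (1 - y\<^sup>2))\<close>.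
  The difference of the two sides has denominator \<open>(1 - y) * (1 - y\<^sup>2)\<close> and numerator
  \<open>1 + 4 * y - 2 * y\<^sup>2 - 5 * y\<^sup>3 + y ^ 6 + 4 * y ^ 7\<close>. One division by \<open>1 - y\<close> makes it
  nonnegative in the sense of partial sums: the quotient is the polynomial \<open>S\<close> below, whose
  negative terms are outweighed by positive ones of lower degree, plus \<open>3 * y ^ 7 / (1 - y)\<close>.\<close>

lemma upper_range:
  assumes "n \<ge> 1"
  shows "fps_X ^ (11*n) * (geo (6*n - 1) * geo (6*n))
           \<sqsubseteq> geo n + fps_X ^ (24*n + 4) * (geo n * (geo (6*n - 1) * geo (6*n)))"
proof -
  define y :: "rat fps" where "y = fps_X ^ (5*n)"
  define S where "S = 1 + 5 * y + 3 * y^2 - 2 * y^3 - 2 * y^4 - 2 * y^5 - y^6"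
  have ypow: "y ^ i \<sqsubseteq> y ^ j" if "j \<le> i" for i j
    unfolding y_def using assms that by (intro X_power_power_psum_anti) auto
  have y0: "0 \<preceq> y" by (simp add: y_def)
  have y0': "0 \<preceq> y ^ i" for i by (simp add: y_def flip: power_mult)
  note pos = nonneg_mult nonneg_geo nonneg_add nonneg_one y0 nonneg_numeral
  \<comment> \<open>Each of the seven negative terms of \<open>S\<close> is matched with a positive one of lower degree.\<close>
  have "2 * y^3 + 2 * y^4 + 2 * y^5 + y^6 \<sqsubseteq> 2 * y^1 + 2 * y^1 + 2 * y^2 + y^0"
    by (intro psum_le_add psum_le_mult_left ypow nonneg_numeral) auto
  also have "\<dots> \<sqsubseteq> 2 * y^1 + 2 * y^1 + 2 * y^2 + y^0 + (y + y^2)"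
    by (subst psum_le_diff_iff) (simp add: coeff_le_imp_psum_le nonneg_add y0 y0')
  finally have S0: "0 \<sqsubseteq> S"
    unfolding psum_le_diff_iff[of "2 * y^3 + 2 * y^4 + 2 * y^5 + y^6"] by (simp add: S_def algebra_simps)
  have g5: "geo (5*n) = (1 + y) * geo (10*n)"
    using geo_double[of "5*n"] assms by (simp add: y_def)
  have c5: "(1 - y) * geo (5*n) = 1" 
    using geo_cancel[of "5*n"] assms by (simp add: y_def)
  have c10: "(1 - y^2) * geo (10*n) = 1" 
    using geo_cancel[of "10*n"] assms by (simp add: y_def flip: power_mult)
  have "0 \<sqsubseteq> geo (10*n) * (S + 3 * y^7 * geo (5*n))"
  proof -
    have "0 + 0 \<sqsubseteq> S + 3 * y^7 * geo (5*n)"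
      by (intro psum_le_add S0 coeff_le_imp_psum_le nonneg_mult y0' nonneg_geo nonneg_numeral) (use assms in auto)
    from psum_le_mult_left[OF _ this, of "geo (10*n)"] show ?thesis
      using assms by (simp add: nonneg_geo)
  qed
  also have "geo (10*n) * (S + 3 * y^7 * geo (5*n))
               = geo (10*n) * geo (5*n) * ((1 - y) * S + 3 * y^7)"
  proof -
    have "geo (10*n) * geo (5*n) * ((1 - y) * S + 3 * y^7)
        = geo (10*n) * (((1 - y) * geo (5*n)) * S + 3 * y^7 * geo (5*n))"
      by (simp only: ring_distribs mult_ac)
    then show ?thesis by (simp only: c5 mult_1_left)
  qed
  also have "(1 - y) * S + 3 * y^7 = (1 + 4*y) * (1 - y^2) + y^6 * (1 + 4*y) - (y^2 + y^3)"
    unfolding S_def by algebra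
  also have "geo (10*n) * geo (5*n) * \<dots> = (1 + 4*y) * geo (5*n) + y^6 * ((1 + 4*y) * geo (5*n) * geo (10*n))
         - y^2 * geo (5*n) * ((1 + y) * geo (10*n))"
  proof -
    have "geo (10*n) * geo (5*n) * ((1 + 4*y) * (1 - y^2) + y^6 * (1 + 4*y) - (y^2 + y^3))
      = (1 + 4*y) * geo (5*n) * ((1 - y^2) * geo (10*n)) + y^6 * ((1 + 4*y) * geo (5*n) * geo (10*n))
         - y^2 * geo (5*n) * ((1 + y) * geo (10*n))"
      by algebra
    then show ?thesis by (simp only: c10 mult_1_right)
  qed
  also have "\<dots> = (1 + 4*y) * geo (5*n) + y^6 * ((1 + 4*y) * geo (5*n) * geo (10*n)) - y^2 * (geo (5*n))^2"
    unfolding g5[symmetric] by algebra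
  finally have 1: "y^2 * (geo (5*n))^2 \<sqsubseteq> (1 + 4*y) * geo (5*n) + y^6 * ((1 + 4*y) * geo (5*n) * geo (10*n))"
    by (simp only: psum_le_diff_iff[of "y^2 * _"])
  have 2: "(1 + 4*y) * geo (5*n) \<sqsubseteq> geo n"
    unfolding y_def by (rule geo_psum_ge[OF assms])
  have 3: "y^6 \<sqsubseteq> fps_X ^ (24*n+4)"
    unfolding y_def power_mult[symmetric] by (rule X_power_psum_anti) (use assms in auto)
  have 4: "geo (10*n) \<sqsubseteq> geo (6*n - 1) * geo (6*n)"
  proof -
    have "geo (10*n) \<sqsubseteq> geo (6*n - 1)" 
      by (rule geo_psum_anti) (use assms in auto)
    also have "\<dots> = geo (6*n - 1) * 1" by simp
    also have "\<dots> \<sqsubseteq> geo (6*n - 1) * geo (6*n)"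
      by (intro psum_le_mult_left coeff_le_imp_psum_le one_le_geo nonneg_geo) (use assms in auto)
    finally show ?thesis .
  qed
  have "fps_X ^ (11*n) * (geo (6*n - 1) * geo (6*n)) \<sqsubseteq> y^2 * (geo (5*n))^2"
    unfolding y_def by (rule pair_psum_le[OF assms])
  also note 1
  also have "(1 + 4*y) * geo (5*n) + y^6 * ((1 + 4*y) * geo (5*n) * geo (10*n))
     \<sqsubseteq> geo n + fps_X ^ (24*n + 4) * (geo n * (geo (6*n - 1) * geo (6*n)))"
    by (intro psum_le_add 2 psum_le_mult 3 4 y0' pos) (use assms in auto)
  finally show ?thesis .
qed

section \<open>Generating functions of pairs of partitions\<close>

definition inv_qfact :: "nat \<Rightarrow> rat fps" where
  "inv_qfact m = (\<Prod>i=1..m. geo i)"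

lemma inv_qfact_Suc: "inv_qfact (Suc m) = inv_qfact m * geo (Suc m)"
  by (simp add: inv_qfact_def)

lemma nonneg_inv_qfact: "0 \<preceq> inv_qfact m"
  unfolding inv_qfact_def by (rule nonneg_prod) (auto intro: nonneg_geo)

lemma inv_qfact_factor:
  assumes "1 \<le> i" "i \<le> m"
  shows "\<exists>R. 0 \<preceq> R \<and> inv_qfact m = geo i * R"
proof (intro exI conjI)
  show "0 \<preceq> (\<Prod>j\<in>{1..m} - {i}. geo j)"
    by (rule nonneg_prod) (auto intro: nonneg_geo)
  show "inv_qfact m = geo i * (\<Prod>j\<in>{1..m} - {i}. geo j)"
    unfolding inv_qfact_def by (rule prod.remove) (use assms in auto)
qed

text \<open>The coefficients count pairs of partitions with parts at most \<open>i\<close> and at most \<open>j\<close>. For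
  \<open>i + j = k\<close> this is the Gaussian binomial coefficient of \<open>k\<close> over \<open>i\<close>, divided by
  \<open>(1 - X) \<cdots> (1 - X ^ k)\<close>.\<close>

definition pair_gf :: "nat \<Rightarrow> nat \<Rightarrow> rat fps" where
  "pair_gf i j = inv_qfact i * inv_qfact j"

lemma pair_gf_commute: "pair_gf i j = pair_gf j i"
  by (simp add: pair_gf_def mult.commute)

lemma nonneg_pair_gf: "0 \<preceq> pair_gf i j"
  by (simp add: pair_gf_def nonneg_mult nonneg_inv_qfact)

text \<open>The difference of the two sides is
  \<open>X ^ Suc j * (1 - X ^ (i - j)) / ((1 - X ^ Suc i) * (1 - X ^ Suc j))\<close> times nonnegative
  factors, and the factor \<open>1 - X ^ (i - j)\<close> cancels against the denominator of \<open>inv_qfact i\<close>.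
  Thus, as for ordinary binomial coefficients, \<open>pair_gf\<close> grows towards the middle of a row.\<close>

lemma pair_gf_balance:
  assumes "j \<le> i" shows "pair_gf (Suc i) j \<preceq> pair_gf i (Suc j)"
proof (cases "i = j")
  case True then show ?thesis by (simp add: pair_gf_commute)
next
  case False
  then have "1 \<le> i - j" "i - j \<le> i" using assms by auto
  then obtain R where R: "0 \<preceq> R" "inv_qfact i = geo (i - j) * R"
    using inv_qfact_factor by blast
  have e: "fps_X ^ Suc i = fps_X ^ Suc j * (fps_X ^ (i - j) :: rat fps)"
    using assms by (simp flip: power_add)
  have c: "(1 - fps_X ^ Suc i) * geo (Suc i) = 1" "(1 - fps_X ^ Suc j) * geo (Suc j) = 1"
    "(1 - fps_X ^ (i - j)) * geo (i - j) = 1"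
    using False assms by (simp_all add: geo_cancel del: power_Suc)
  have "geo (Suc j) - geo (Suc i) = geo (Suc i) * geo (Suc j) * (fps_X ^ Suc j * (1 - fps_X ^ (i - j)))"
  proof -
    have "G' - G = G * G' * (A * (1 - B))" if "(1 - A * B) * G = 1" "(1 - A) * G' = 1" for A B G G' :: "rat fps"
      using that by algebra
    then show ?thesis using c(1,2) unfolding e by blast
  qed
  then have "geo (i - j) * (geo (Suc j) - geo (Suc i))
      = geo (Suc i) * geo (Suc j) * fps_X ^ Suc j * ((1 - fps_X ^ (i - j)) * geo (i - j))"
    by (simp only: mult_ac)
  then have *: "geo (i - j) * (geo (Suc j) - geo (Suc i)) = geo (Suc i) * geo (Suc j) * fps_X ^ Suc j"
    by (simp only: c mult_1_right)
  have "pair_gf i (Suc j) - pair_gf (Suc i) j = R * inv_qfact j * (geo (i - j) * (geo (Suc j) - geo (Suc i)))"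
    unfolding pair_gf_def inv_qfact_Suc R(2) by algebra
  then show ?thesis
    unfolding coeff_le_diff_iff[of "pair_gf (Suc i) j"] *
    by (simp add: R nonneg_mult nonneg_inv_qfact nonneg_geo del: power_Suc)
qed

text \<open>This is how comparisons of partial sums are used: \<open>inv_qfact m\<close> provides the factor
  \<open>1 / (1 - X)\<close>.\<close>

lemma psum_le_imp_coeff_le:
  assumes "F \<sqsubseteq> G" "1 \<le> m" "0 \<preceq> R" shows "inv_qfact m * R * F \<preceq> inv_qfact m * R * G"
proof -
  obtain R' where R': "0 \<preceq> R'" "inv_qfact m = geo 1 * R'"
    using inv_qfact_factor[of 1 m] assms by auto
  have "R' * R * (geo 1 * F) \<preceq> R' * R * (geo 1 * G)"
    using assms(1) unfolding psum_le_def by (rule coeff_le_mult_left[OF nonneg_mult[OF R'(1) assms(3)]])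
  then show ?thesis by (simp add: R' mult_ac)
qed

lemma pair_gf_expand:
  assumes "n \<ge> 1"
  shows "pair_gf (6*n) b = pair_gf (6*n - 2) b * (geo (6*n - 1) * geo (6*n))"
proof -
  have "6*n = Suc (Suc (6*n - 2))" "6*n - 1 = Suc (6*n - 2)" using assms by auto
  then show ?thesis by (metis (no_types, lifting) pair_gf_def inv_qfact_Suc mult.assoc mult.commute)
qed

text \<open>Moves the factor \<open>1 - X ^ n\<close> of \<open>X ^ (11 * n) * (1 - X ^ n) * pair_gf (6 * n) b\<close> against
  the denominator of \<open>inv_qfact (6 * n - 2)\<close>.\<close>

lemma pair_gf_split:
  assumes "n \<ge> 1" "inv_qfact (6*n - 2) = geo n * R"
  shows "fps_X ^ (11*n) * pair_gf (6*n) b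
     = inv_qfact b * R * (fps_X ^ (11*n) * (geo (6*n - 1) * geo (6*n))) + fps_X ^ (12*n) * pair_gf (6*n) b"
proof -
  have *: "x * (g * R * B * P) = B * R * (x * P) + (x * a) * (g * R * B * P)"
    if "(1 - a) * g = 1" for a x g B P :: "rat fps"
    using that by algebra
  have "fps_X ^ (12*n) = fps_X ^ (11*n) * (fps_X ^ n :: rat fps)" by (simp flip: power_add)
  then show ?thesis
    unfolding pair_gf_expand[OF assms(1)] pair_gf_def[of "6*n - 2"] assms(2)
    by (simp only: *[OF geo_cancel[OF assms(1)], of "fps_X ^ (11*n)" "inv_qfact b"])
qed

text \<open>The heart of the proof. Left of the middle of a row \<open>pair_gf\<close> increases with its first
  argument, and right of it \<open>pair_gf\<close> decreases, so far away from the middle one of the two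
  neighbours \<open>pair_gf (6 * n - 2) (b + 2)\<close> and \<open>pair_gf (6 * n + 2) (b - 2)\<close> is large. For
  small \<open>b\<close> the first neighbour alone suffices by monotonicity. Otherwise the second summand on
  the right is subtracted from the left-hand side; the resulting factor \<open>1 - X ^ n\<close> cancels a
  geometric series and so lowers the order of growth. If \<open>b < 10 * n\<close>, the first neighbour then
  dominates by \<open>middle_range\<close>. If \<open>b \<ge> 10 * n\<close>, it dominates only in low degrees, and the
  second neighbour, at least \<open>pair_gf (6 * n) b\<close>, takes care of high degrees; this is
  \<open>upper_range\<close>.\<close>

lemma pair_gf_domination:
  assumes "n \<ge> 1"
  shows "fps_X ^ (11*n) * pair_gf (6*n) b
     \<preceq> pair_gf (6*n - 2) (b + 2) + fps_X ^ (12*n) * pair_gf (6*n) b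
       + (if 2 \<le> b then fps_X ^ (24*n + 4) * pair_gf (6*n + 2) (b - 2) else 0)"
proof -
  let ?P = "geo (6*n - 1) * geo (6*n)"
  let ?last = "if 2 \<le> b then fps_X ^ (24*n + 4) * pair_gf (6*n + 2) (b - 2) else 0"
  have last0: "0 \<preceq> ?last" by (simp add: nonneg_mult nonneg_pair_gf)
  consider "b + 3 \<le> 6*n" | "6*n - 2 \<le> b" "b + 1 \<le> 10*n" | "10*n \<le> b" by linarith
  then show ?thesis
  proof cases
    case 1
    have "inv_qfact (6*n) * inv_qfact b * fps_X ^ (11*n) \<preceq> inv_qfact (6*n) * inv_qfact b * fps_X ^ 0"
      by (intro psum_le_imp_coeff_le X_power_psum_anti nonneg_inv_qfact) (use assms in auto)
    then have "fps_X ^ (11*n) * pair_gf (6*n) b \<preceq> pair_gf (6*n) b"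
      by (simp add: pair_gf_def mult_ac)
    also have "\<dots> \<preceq> pair_gf (6*n - 1) (b + 1)"
      using pair_gf_balance[of b "6*n - 1"] 1 assms by simp
    also have "\<dots> \<preceq> pair_gf (6*n - 2) (b + 2)"
    proof -
      have "Suc (6*n - 2) = 6*n - 1" using assms by auto
      then show ?thesis using pair_gf_balance[of "b + 1" "6*n - 2"] 1 by simp
    qed
    also have "\<dots> = pair_gf (6*n - 2) (b + 2) + 0 + 0" by simp
    also have "\<dots> \<preceq> pair_gf (6*n - 2) (b + 2) + fps_X ^ (12*n) * pair_gf (6*n) b + ?last"
      by (intro coeff_le_add last0 nonneg_mult nonneg_pair_gf) auto
    finally show ?thesis .
  next
    case 2
    have "n \<le> 6*n - 2" using assms by auto
    then obtain R where R: "0 \<preceq> R" "inv_qfact (6*n - 2) = geo n * R"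
      using inv_qfact_factor assms by blast
    have "inv_qfact b * R * (fps_X ^ (11*n) * ?P) \<preceq> inv_qfact b * R * (geo n * (geo (b+1) * geo (b+2)))"
      by (intro psum_le_imp_coeff_le middle_range R) (use assms 2 in linarith)+
    also have "\<dots> = pair_gf (6*n - 2) (b + 2)"
      unfolding pair_gf_def R by (simp add: inv_qfact_Suc mult_ac)
    finally have *: "inv_qfact b * R * (fps_X ^ (11*n) * ?P) \<preceq> pair_gf (6*n - 2) (b + 2)" .
    have "fps_X ^ (11*n) * pair_gf (6*n) b = inv_qfact b * R * (fps_X ^ (11*n) * ?P) + fps_X ^ (12*n) * pair_gf (6*n) b"
      by (rule pair_gf_split[OF assms R(2)])
    also have "\<dots> \<preceq> pair_gf (6*n - 2) (b + 2) + fps_X ^ (12*n) * pair_gf (6*n) b"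
      by (intro coeff_le_add * coeff_le_refl)
    also have "\<dots> = \<dots> + 0" by simp
    also have "\<dots> \<preceq> pair_gf (6*n - 2) (b + 2) + fps_X ^ (12*n) * pair_gf (6*n) b + ?last"
      by (intro coeff_le_add last0 coeff_le_refl)
    finally show ?thesis .
  next
    case 3
    have "n \<le> 6*n - 2" using assms by auto
    then obtain R where R: "0 \<preceq> R" "inv_qfact (6*n - 2) = geo n * R"
      using inv_qfact_factor assms by blast
    have "inv_qfact b * R * (fps_X ^ (11*n) * ?P)
        \<preceq> inv_qfact b * R * (geo n + fps_X ^ (24*n + 4) * (geo n * ?P))"
      by (intro psum_le_imp_coeff_le upper_range R) (use assms 3 in auto)
    also have "\<dots> = pair_gf (6*n - 2) b + fps_X ^ (24*n + 4) * pair_gf (6*n) b"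
      unfolding pair_gf_expand[OF assms] unfolding pair_gf_def R by (simp only: distrib_left mult_ac)
    finally have *: "inv_qfact b * R * (fps_X ^ (11*n) * ?P) \<preceq> pair_gf (6*n - 2) b + fps_X ^ (24*n + 4) * pair_gf (6*n) b" .
    \<comment> \<open>In low degrees the loss of two factors of the first neighbour is affordable.\<close>
    have "pair_gf (6*n - 2) b * (1 * 1) \<preceq> pair_gf (6*n - 2) b * (geo (b+1) * geo (b+2))"
    proof (intro coeff_le_mult_left nonneg_pair_gf)
      have "1 * 1 \<preceq> geo (b+1) * 1" by (simp add: one_le_geo)
      also have "\<dots> \<preceq> geo (b+1) * geo (b+2)" 
        by (intro coeff_le_mult_left nonneg_geo one_le_geo) auto
      finally show "1 * 1 \<preceq> geo (b+1) * geo (b+2)" .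
    qed
    then have low: "pair_gf (6*n - 2) b \<preceq> pair_gf (6*n - 2) (b + 2)"
      by (simp add: pair_gf_def inv_qfact_Suc mult_ac)
    have "pair_gf (6*n) b \<preceq> pair_gf (6*n + 1) (b - 1)"
      using pair_gf_balance[of "6*n" "b - 1"] 3 assms by (simp add: pair_gf_commute)
    also have "\<dots> \<preceq> pair_gf (6*n + 2) (b - 2)"
    proof -
      have "Suc (b - 2) = b - 1" using 3 assms by auto
      then show ?thesis using pair_gf_balance[of "6*n + 1" "b - 2"] 3 assms by (simp add: pair_gf_commute)
    qed
    finally have up: "fps_X ^ (24*n + 4) * pair_gf (6*n) b \<preceq> ?last"
      using 3 assms by (simp add: coeff_le_mult_left)
    have "fps_X ^ (11*n) * pair_gf (6*n) b = inv_qfact b * R * (fps_X ^ (11*n) * ?P) + fps_X ^ (12*n) * pair_gf (6*n) b"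
      by (rule pair_gf_split[OF assms R(2)])
    also have "\<dots> \<preceq> pair_gf (6*n - 2) b + fps_X ^ (24*n + 4) * pair_gf (6*n) b + fps_X ^ (12*n) * pair_gf (6*n) b"
      by (intro coeff_le_add * coeff_le_refl)
    also have "\<dots> \<preceq> pair_gf (6*n - 2) (b + 2) + ?last + fps_X ^ (12*n) * pair_gf (6*n) b"
      by (intro coeff_le_add low up coeff_le_refl)
    also have "\<dots> = pair_gf (6*n - 2) (b + 2) + fps_X ^ (12*n) * pair_gf (6*n) b + ?last"
      by (simp only: add_ac)
    finally show ?thesis .
  qed
qed

section \<open>The integer trace of a generalized Gaussian binomial coefficient\<close>

declare One_nat_def [simp del]

lemma ram1_power_X: "ram 1 (fps_X ^ i) = qpow (of_nat i)"
  using qpow_eq_ram[of 1 i] by simp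

lemma ram1_mult: "ram 1 (F * G) = ram 1 F * ram 1 G"
  by (simp add: ram_mult)

lemma ram1_add: "ram 1 (F + G) = ram 1 F + ram 1 G"
  by (simp add: ram_add)

lemma ram1_diff: "ram 1 (F - G) = ram 1 F - ram 1 G"
  by (simp add: ram_diff)

lemma ram1_prod: "ram 1 (prod F A) = (\<Prod>i\<in>A. ram 1 (F i))"
  by (induction A rule: infinite_finite_induct) (simp_all add: ram1_mult flip: ram_1)

lemma pcoeff_qpow_mult:
  assumes "\<alpha> \<ge> 0"
  shows "pcoeff (qpow \<alpha> * A) x = pcoeff A (x - \<alpha>)"
proof -
  have "{y. pcoeff (qpow \<alpha>) y \<noteq> 0 \<and> pcoeff A (x - y) \<noteq> 0} = (if pcoeff A (x - \<alpha>) = 0 then {} else {\<alpha>})"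
    using assms by (auto simp: qpow.rep_eq)
  then show ?thesis
    using assms by (simp add: times_puiseux.rep_eq qpow.rep_eq)
qed

lemma qpow_power: "\<alpha> \<ge> 0 \<Longrightarrow> qpow \<alpha> ^ j = qpow (of_nat j * \<alpha>)"
proof (induction j)
  case (Suc j)
  then show ?case using qpow_add[of \<alpha> "of_nat j * \<alpha>"] by (simp add: distrib_right)
qed (simp add: qpow_0)

lemma pcoeff_sum: "pcoeff (sum F A) x = (\<Sum>i\<in>A. pcoeff (F i) x)"
  by (induction A rule: infinite_finite_induct) (simp_all add: zero_puiseux.rep_eq plus_puiseux.rep_eq)

definition qfact :: "nat \<Rightarrow> rat fps" where
  "qfact k = (\<Prod>i=1..k. 1 - fps_X ^ i)"

lemma qfact_Suc: "qfact (Suc k) = qfact k * (1 - fps_X ^ Suc k)"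
  by (simp add: qfact_def del: power_Suc)

lemma inv_qfact_shift: "(1 - fps_X ^ Suc m) * inv_qfact (Suc m) = inv_qfact m"
proof -
  have "(1 - fps_X ^ Suc m) * inv_qfact (Suc m) = ((1 - fps_X ^ Suc m) * geo (Suc m)) * inv_qfact m"
    by (simp only: inv_qfact_Suc mult_ac)
  then show ?thesis by (simp only: geo_cancel le_add1 plus_1_eq_Suc mult_1_left)
qed

definition tri :: "nat \<Rightarrow> nat" where "tri j = j * (j + 1) div 2"

lemma tri_Suc: "tri (Suc j) = tri j + Suc j"
proof -
  have "Suc j * (Suc j + 1) = j * (j + 1) + Suc j * 2" by simp
  then have "tri (Suc j) = (j * (j + 1) + Suc j * 2) div 2" by (simp only: tri_def)
  also have "\<dots> = Suc j + j * (j + 1) div 2" by (rule div_mult_self1) simp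
  finally show ?thesis by (simp only: tri_def add.commute)
qed

text \<open>The value 0 beyond the end of the row makes Pascal's rule hold there as well.\<close>

definition pair_row :: "nat \<Rightarrow> nat \<Rightarrow> rat fps" where
  "pair_row k j = (if j \<le> k then pair_gf j (k - j) else 0)"

lemma pair_row_pascal_0: "(1 - fps_X ^ Suc k) * pair_row (Suc k) 0 = pair_row k 0"
  using inv_qfact_shift[of k] by (simp add: pair_row_def pair_gf_def inv_qfact_def del: power_Suc)

lemma pair_row_pascal_Suc:
  assumes "j \<le> k"
  shows "(1 - fps_X ^ Suc k) * pair_row (Suc k) (Suc j) = pair_row k (Suc j) + fps_X ^ (k - j) * pair_row k j"
proof (cases "j = k")
  case True
  then show ?thesis
    using inv_qfact_shift[of k] by (simp add: pair_row_def pair_gf_def inv_qfact_def del: power_Suc)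
next
  case False
  then obtain i where k: "k = j + Suc i"
    using assms less_iff_Suc_add[of j k] by auto
  have e: "fps_X ^ Suc k = fps_X ^ Suc i * (fps_X ^ Suc j :: rat fps)"
    by (simp add: k flip: power_add)
  have d: "pair_row (Suc k) (Suc j) = inv_qfact (Suc j) * inv_qfact (Suc i)"
    "pair_row k (Suc j) = inv_qfact (Suc j) * inv_qfact i"
    "pair_row k j = inv_qfact j * inv_qfact (Suc i)" "k - j = Suc i"
    by (simp_all add: pair_row_def pair_gf_def k)
  show ?thesis
  proof -
    have "(1 - A * B) * (F * G) = F * ((1 - A) * G) + A * (((1 - B) * F) * G)" for A B F G :: "rat fps"
      by algebra
    then show ?thesis
      unfolding d e by (simp only: inv_qfact_shift)
  qed
qed

text \<open>The \<open>q\<close>-binomial theorem. The parameter \<open>z\<close> ranges over Puiseux series, so that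
  \<open>z = qpow r\<close> with a fractional exponent is possible; all other factors are power series in \<open>q\<close>.
  The induction multiplies by \<open>1 - q ^ Suc k\<close> and applies Pascal's rule.\<close>

lemma q_binomial:
  "(\<Prod>i=1..k. 1 - z * ram 1 (fps_X ^ i))
     = ram 1 (qfact k) * (\<Sum>j\<le>k. (- z) ^ j * ram 1 (fps_X ^ tri j * pair_row k j))"
proof (induction k)
  case 0
  show ?case by (simp add: qfact_def pair_row_def pair_gf_def inv_qfact_def tri_def flip: ram_1)
next
  case (Suc k)
  let ?T = "\<lambda>k j. (- z) ^ j * ram 1 (fps_X ^ tri j * pair_row k j)"
  let ?w = "ram 1 (1 - fps_X ^ Suc k)"
  have 0: "?w * ?T (Suc k) 0 = ?T k 0"
    using pair_row_pascal_0[of k] by (simp add: tri_def del: power_Suc flip: ram1_mult)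
  have S: "?w * ?T (Suc k) (Suc j) = ?T k (Suc j) - z * ram 1 (fps_X ^ Suc k) * ?T k j" if "j \<le> k" for j
  proof -
    have e: "fps_X ^ tri (Suc j) * fps_X ^ (k - j) = (fps_X ^ Suc k * fps_X ^ tri j :: rat fps)"
      unfolding power_add[symmetric] tri_Suc using that by simp
    have "?w * ?T (Suc k) (Suc j)
        = (- z) ^ Suc j * ram 1 (fps_X ^ tri (Suc j) * ((1 - fps_X ^ Suc k) * pair_row (Suc k) (Suc j)))"
      by (simp only: ram1_mult mult_ac)
    also have "\<dots> = (- z) ^ Suc j * ram 1 (fps_X ^ tri (Suc j) * pair_row k (Suc j))
         + (- z) ^ Suc j * ram 1 ((fps_X ^ tri (Suc j) * fps_X ^ (k - j)) * pair_row k j)"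
      unfolding pair_row_pascal_Suc[OF that] by (simp only: distrib_left ram1_add mult_ac)
    finally show ?thesis
      unfolding e by (simp add: ram1_mult mult_ac del: power_Suc) (simp add: mult_ac)
  qed
  have z: "?T k (Suc k) = 0" by (simp add: pair_row_def flip: ram_0)
  have "?w * (\<Sum>j\<le>Suc k. ?T (Suc k) j) = ?w * ?T (Suc k) 0 + (\<Sum>j\<le>k. ?w * ?T (Suc k) (Suc j))"
    by (simp only: sum.atMost_Suc_shift distrib_left sum_distrib_left)
  also have "\<dots> = ?T k 0 + (\<Sum>j\<le>k. ?T k (Suc j) - z * ram 1 (fps_X ^ Suc k) * ?T k j)"
    unfolding 0 by (intro arg_cong2[of _ _ _ _ "(+)"] refl sum.cong S) auto
  also have "\<dots> = (?T k 0 + (\<Sum>j\<le>k. ?T k (Suc j))) - z * ram 1 (fps_X ^ Suc k) * (\<Sum>j\<le>k. ?T k j)"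
    by (simp only: sum_subtractf sum_distrib_left add_diff_eq)
  also have "?T k 0 + (\<Sum>j\<le>k. ?T k (Suc j)) = (\<Sum>j\<le>k. ?T k j)"
  proof -
    have "?T k 0 + (\<Sum>j\<le>k. ?T k (Suc j)) = (\<Sum>j\<le>Suc k. ?T k j)"
      by (rule sum.atMost_Suc_shift[symmetric])
    then show ?thesis by (simp only: sum.atMost_Suc z add_0_right)
  qed
  finally have *: "?w * (\<Sum>j\<le>Suc k. ?T (Suc k) j) = (1 - z * ram 1 (fps_X ^ Suc k)) * (\<Sum>j\<le>k. ?T k j)"
    by (simp only: left_diff_distrib mult_1_left)
  have "(\<Prod>i=1..Suc k. 1 - z * ram 1 (fps_X ^ i))
      = (\<Prod>i=1..k. 1 - z * ram 1 (fps_X ^ i)) * (1 - z * ram 1 (fps_X ^ Suc k))"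
    by simp
  also have "\<dots> = ram 1 (qfact k) * ((1 - z * ram 1 (fps_X ^ Suc k)) * (\<Sum>j\<le>k. ?T k j))"
    unfolding Suc.IH by (simp only: mult_ac)
  also have "\<dots> = ram 1 (qfact (Suc k)) * (\<Sum>j\<le>Suc k. ?T (Suc k) j)"
    unfolding *[symmetric] qfact_Suc ram1_mult[of "qfact k"] by (simp only: mult_ac)
  finally show ?case .
qed

lemma gauss_binom_expand:
  assumes "r \<ge> 0"
  shows "gauss_binom r k = (\<Sum>j\<le>k. qpow r ^ j * ram 1 ((- 1) ^ j * fps_X ^ tri j * pair_row k j))"
proof -
  have den: "(\<Prod>i=1..k. 1 - qpow (of_nat i)) = ram 1 (qfact k)"
    by (simp add: qfact_def ram1_prod ram1_diff ram1_power_X flip: ram_1)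
  have "(\<Prod>i=1..k. 1 - qpow (r + of_nat i)) = (\<Prod>i=1..k. 1 - qpow r * ram 1 (fps_X ^ i))"
    using assms by (simp add: qpow_add ram1_power_X)
  also have "\<dots> = ram 1 (qfact k) * (\<Sum>j\<le>k. (- qpow r) ^ j * ram 1 (fps_X ^ tri j * pair_row k j))"
    by (rule q_binomial)
  also have "(\<Sum>j\<le>k. (- qpow r) ^ j * ram 1 (fps_X ^ tri j * pair_row k j))
      = (\<Sum>j\<le>k. qpow r ^ j * ram 1 ((- 1) ^ j * fps_X ^ tri j * pair_row k j))" (is "_ = ?S")
  proof (rule sum.cong[OF refl])
    fix j
    have "ram 1 ((- 1) ^ j * F) = (- 1) ^ j * ram 1 F" for F
      by (cases "even j") (simp_all add: ram_uminus)
    then show "(- qpow r) ^ j * ram 1 (fps_X ^ tri j * pair_row k j)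
      = qpow r ^ j * ram 1 ((- 1) ^ j * fps_X ^ tri j * pair_row k j)"
      unfolding power_minus[of "qpow r" j] mult.assoc by (simp only: mult.left_commute[of "(- 1) ^ j" "qpow r ^ j"])
  qed
  finally have "gauss_binom r k = (ram 1 (qfact k) * inverse (ram 1 (qfact k))) * ?S"
    unfolding gauss_binom_def divide_puiseux_def den by (simp only: mult_ac)
  then show ?thesis
    using puiseux_inverse[OF qfact_unit[of k]] by (simp only: den mult_1_left)
qed

text \<open>The exponents that occur are \<open>j / b\<close> plus integers, so the term either lies in the integer
  trace as a whole or does not meet it.\<close>

lemma pcoeff_root_term:
  assumes "b \<ge> 1"
  shows "pcoeff (qpow (1 / of_nat b) ^ j * ram 1 F) (of_nat d)
           = (if b dvd j then fps_nth (fps_X ^ (j div b) * F) d else 0)"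
proof -
  have "pcoeff (qpow (1 / of_nat b) ^ j * ram 1 F) (of_nat d) = pcoeff (ram 1 F) (of_nat d - of_nat j / of_nat b)"
    by (simp add: qpow_power pcoeff_qpow_mult)
  also have "\<dots> = (if b dvd j then fps_nth (fps_X ^ (j div b) * F) d else 0)"
  proof (cases "\<exists>n::nat. (of_nat d - of_nat j / of_nat b :: rat) = of_nat n")
    case True
    then obtain n :: nat where n: "(of_nat d - of_nat j / of_nat b :: rat) = of_nat n" by blast
    then have "(of_nat (b * d) :: rat) = of_nat (j + b * n)"
      using assms by (simp add: field_simps)
    then have "b * d = j + b * n" by (simp only: of_nat_eq_iff)
    then have "b dvd j" "d = j div b + n"
      using assms by (metis dvd_add_left_iff dvd_triv_left, 
        metis add.commute div_mult_self4 mult.commute nonzero_mult_div_cancel_left not_one_le_zero)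
    then show ?thesis
      using pcoeff_ram_nat[of 1 F n] n by (simp add: fps_X_power_mult_nth)
  next
    case False
    have "fps_nth (fps_X ^ (j div b) * F) d = 0" if "b dvd j"
    proof -
      have "(of_nat d - of_nat j / of_nat b :: rat) = of_nat d - of_nat (j div b)"
        using that assms by (auto elim!: dvdE)
      then have "\<not> j div b \<le> d" using False by (metis of_nat_diff)
      then show ?thesis by (simp add: fps_X_power_mult_nth)
    qed
    then show ?thesis
      using pcoeff_ram_not[of 1 "of_nat d - of_nat j / of_nat b" F] False by simp
  qed
  finally show ?thesis .
qed

lemma int_trace_gauss_binom:
  assumes "b \<ge> 1"
  shows "int_trace (gauss_binom (1 / of_nat b) k)
           = (\<Sum>j\<in>{j. j \<le> k \<and> b dvd j}. (- 1) ^ j * fps_X ^ (j div b + tri j) * pair_gf j (k - j))"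
proof (rule fps_ext)
  fix d
  have "fps_nth (int_trace (gauss_binom (1 / of_nat b) k)) d
      = (\<Sum>j\<le>k. if b dvd j then fps_nth (fps_X ^ (j div b) * ((- 1) ^ j * fps_X ^ tri j * pair_row k j)) d else 0)"
    using assms by (simp add: int_trace_def gauss_binom_expand pcoeff_sum pcoeff_root_term)
  also have "\<dots> = (\<Sum>j\<in>{j. j \<le> k \<and> b dvd j}. fps_nth (fps_X ^ (j div b) * ((- 1) ^ j * fps_X ^ tri j * pair_row k j)) d)"
    by (simp add: sum.If_cases Int_def)
  also have "\<dots> = (\<Sum>j\<in>{j. j \<le> k \<and> b dvd j}. fps_nth ((- 1) ^ j * fps_X ^ (j div b + tri j) * pair_gf j (k - j)) d)"
    by (intro sum.cong refl arg_cong2[of _ _ _ _ fps_nth]) (simp add: pair_row_def power_add mult_ac)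
  finally show "fps_nth (int_trace (gauss_binom (1 / of_nat b) k)) d
    = fps_nth (\<Sum>j\<in>{j. j \<le> k \<and> b dvd j}. (- 1) ^ j * fps_X ^ (j div b + tri j) * pair_gf j (k - j)) d"
    by (simp add: fps_sum_nth)
qed

section \<open>Grouping the terms of the traces\<close>

definition trace_term :: "nat \<Rightarrow> nat \<Rightarrow> nat \<Rightarrow> rat fps" where
  "trace_term b k j = fps_X ^ (j div b + tri j) * pair_gf j (k - j)"

lemma nonneg_trace_term: "0 \<preceq> trace_term b k j"
  by (simp add: trace_term_def nonneg_mult nonneg_pair_gf)

lemma coeff_le_sum_mono:
  assumes "finite B" "A \<subseteq> B" "\<And>i. i \<in> B \<Longrightarrow> 0 \<preceq> F i"
  shows "sum F A \<preceq> sum F B"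
  using assms by (auto simp: coeff_le_def fps_sum_nth intro!: sum_mono2)

text \<open>The three indices \<open>6 * n - 2\<close>, \<open>6 * n\<close>, \<open>6 * n + 2\<close> are those \<open>j\<close> with
  \<open>(j + 2) div 6 = n\<close>. Relative to \<open>6 * n * (3 * n - 1)\<close>, the exponents of their terms are
  \<open>0\<close>, \<open>12 * n\<close>, \<open>24 * n + 4\<close>, and the exponent on the left-hand side is \<open>11 * n\<close>: the
  situation of \<open>pair_gf_domination\<close>.\<close>

lemma trace_term_domination:
  assumes "6*n \<le> k"
  shows "trace_term 3 k (6*n) \<preceq> (\<Sum>j\<in>{j\<in>{j. j \<le> k \<and> 2 dvd j}. (j + 2) div 6 = n}. trace_term 2 k j)"
    (is "_ \<preceq> sum _ ?A")
proof (cases "n = 0")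
  case True
  have "sum (trace_term 2 k) {0} \<preceq> sum (trace_term 2 k) ?A"
    by (rule coeff_le_sum_mono) (use True in \<open>auto simp: nonneg_trace_term\<close>)
  then show ?thesis using True by (simp add: trace_term_def)
next
  case False
  define m where "m = n - 1"
  have n: "n = Suc m" using False by (simp add: m_def)
  let ?b = "k - 6*n"
  let ?e = "6*n*(3*n - 1)"
  have e: "6*n div 3 + tri (6*n) = ?e + 11*n" "(6*n - 2) div 2 + tri (6*n - 2) = ?e"
    "6*n div 2 + tri (6*n) = ?e + 12*n" "(6*n + 2) div 2 + tri (6*n + 2) = ?e + (24*n + 4)"
    unfolding n tri_def by (simp_all add: algebra_simps)
  have b: "k - (6*n - 2) = ?b + 2" "2 \<le> ?b \<Longrightarrow> k - (6*n + 2) = ?b - 2"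
    using assms n by auto
  have "trace_term 3 k (6*n) = fps_X ^ ?e * (fps_X ^ (11*n) * pair_gf (6*n) ?b)"
    unfolding trace_term_def e power_add by (simp only: mult_ac)
  also have "\<dots> \<preceq> fps_X ^ ?e * (pair_gf (6*n - 2) (?b + 2) + fps_X ^ (12*n) * pair_gf (6*n) ?b
       + (if 2 \<le> ?b then fps_X ^ (24*n + 4) * pair_gf (6*n + 2) (?b - 2) else 0))"
    by (intro coeff_le_mult_left pair_gf_domination) (use n in auto)
  also have "\<dots> = trace_term 2 k (6*n - 2) + trace_term 2 k (6*n)
       + (if 2 \<le> ?b then trace_term 2 k (6*n + 2) else 0)"
  proof -
    have "trace_term 2 k (6*n - 2) = fps_X ^ ?e * pair_gf (6*n - 2) (?b + 2)"
      unfolding trace_term_def e(2) b(1) by (rule refl)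
    moreover have "trace_term 2 k (6*n) = fps_X ^ ?e * (fps_X ^ (12*n) * pair_gf (6*n) ?b)"
      unfolding trace_term_def e(3) power_add by (simp only: mult.assoc)
    moreover have "trace_term 2 k (6*n + 2) = fps_X ^ ?e * (fps_X ^ (24*n + 4) * pair_gf (6*n + 2) (?b - 2))"
      if "2 \<le> ?b"
      unfolding trace_term_def e(4) power_add[of fps_X ?e] b(2)[OF that] by (simp only: mult.assoc)
    ultimately show ?thesis
      by (cases "2 \<le> ?b") (simp_all only: distrib_left mult_zero_right if_True if_False)
  qed
  also have "\<dots> = sum (trace_term 2 k) ({6*n - 2, 6*n} \<union> (if 2 \<le> ?b then {6*n + 2} else {}))"
    using n by (simp add: add_ac)
  also have "\<dots> \<preceq> sum (trace_term 2 k) ?A"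
  proof (rule coeff_le_sum_mono)
    show "{6*n - 2, 6*n} \<union> (if 2 \<le> ?b then {6*n + 2} else {}) \<subseteq> ?A"
      using assms n by auto
  qed (simp_all add: nonneg_trace_term)
  finally show ?thesis .
qed

lemma int_trace_domination:
  "int_trace (gauss_binom (1/3) k) \<preceq> int_trace (gauss_binom (1/2) k)"
proof -
  have "int_trace (gauss_binom (1/3) k) = (\<Sum>j\<in>{j. j \<le> k \<and> 3 dvd j}. (- 1) ^ j * trace_term 3 k j)"
    using int_trace_gauss_binom[of 3 k] by (simp add: trace_term_def mult.assoc)
  \<comment> \<open>The terms of odd index enter the smaller trace with a negative sign.\<close>
  also have "\<dots> \<preceq> (\<Sum>j\<in>{j. j \<le> k \<and> 3 dvd j}. if even j then trace_term 3 k j else 0)"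
  proof (rule coeff_le_sum)
    fix j show "(- 1) ^ j * trace_term 3 k j \<preceq> (if even j then trace_term 3 k j else 0)"
      using nonneg_trace_term[of 3 k j] by (simp add: coeff_le_def)
  qed
  also have "\<dots> = (\<Sum>j\<in>{j. j \<le> k \<and> 6 dvd j}. trace_term 3 k j)"
  proof -
    have "{j. j \<le> k \<and> 3 dvd j} \<inter> {j. even j} = {j. j \<le> k \<and> 6 dvd j}" by auto
    then show ?thesis by (simp add: sum.If_cases)
  qed
  also have "\<dots> = (\<Sum>n\<in>{n. 6*n \<le> k}. trace_term 3 k (6*n))"
    by (rule sum.reindex_bij_witness[of _ "\<lambda>n. 6*n" "\<lambda>j. j div 6"]) auto
  also have "\<dots> \<preceq> (\<Sum>n\<in>{n. 6*n \<le> k}. \<Sum>j\<in>{j\<in>{j. j \<le> k \<and> 2 dvd j}. (j + 2) div 6 = n}. trace_term 2 k j)"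
    by (intro coeff_le_sum trace_term_domination) auto
  also have "\<dots> \<preceq> (\<Sum>n\<in>{..k}. \<Sum>j\<in>{j\<in>{j. j \<le> k \<and> 2 dvd j}. (j + 2) div 6 = n}. trace_term 2 k j)"
    by (intro coeff_le_sum_mono nonneg_sum nonneg_trace_term) auto
  \<comment> \<open>The groups \<open>(j + 2) div 6 = n\<close> partition the even indices.\<close>
  also have "\<dots> = (\<Sum>j\<in>{j. j \<le> k \<and> 2 dvd j}. trace_term 2 k j)"
    by (rule sum.group) auto
  also have "\<dots> = (\<Sum>j\<in>{j. j \<le> k \<and> 2 dvd j}. (- 1) ^ j * trace_term 2 k j)"
    by (intro sum.cong) auto
  also have "\<dots> = int_trace (gauss_binom (1/2) k)"
    using int_trace_gauss_binom[of 2 k] by (simp add: trace_term_def mult.assoc)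
  finally show ?thesis .
qed

theorem proposition6p3:
  fixes k :: nat
  assumes "1 \<le> k" and "k \<le> 150"
  shows "gauss_binom (1/2) k \<ge>\<^sub>q gauss_binom (1/3) k"
  using int_trace_domination[of k]
  by (simp add: q_geq_def coeff_le_def int_trace_def minus_puiseux.rep_eq)

end
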